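(* Let $k\ge 2$ and let $g=(g_1,g_2)\sigma^i\in B_k$ with $g_1,g_2\in B_{k-1}$ and $i\in\{0,1\}$. Then $g$ belongs to $G_k'$ if and only if $g\in G_k$, $g$ has even index on $X^l$ for all $0\le l<k-1$, and both $g_1$ and $g_2$ have even index on level $X^{k-2}$ (that is, in each of the two subtrees hanging from the two vertices of the first level of $X^{[k]}$, the number of active vertices of $g$ on level $k-2$ of that subtree, which is level $k-1$ of $X^{[k]}$, is even).
   Context: $G'=[G,G]$ is the derived subgroup. $C_2=\langle\sigma\rangle$ with $\sigma=(1,2)$. For a group $B$, elements of $B\wr C_2$ are written $(g_1,g_2)\pi$ with $g_1,g_2\in B$ and $\pi\in C_2$, with multiplication $(g_1,g_2)\pi_g\cdot(h_1,h_2)\pi_h=(g_1h_{\pi_g(1)},g_2h_{\pi_g(2)})\pi_g\pi_h$. Define $B_1=C_2$ and $B_k=B_{k-1}\wr C_2$ for $k>1$. Define $G_1=\{e\}$ and $G_k=\{(g_1,g_2)\pi\in B_k\mid g_1g_2\in G_{k-1}\}$ for $k>1$ ($G_k$ is isomorphic to a Sylow 2-subgroup of $A_{2^k}$). $B_k$ is identified with the automorphism group of the rooted binary tree $X^{[k]}$ with levels $X^0,\ldots,X^k$, where $|X^l|=2^l$. A vertex $v\in X^l$ ($l<k$) is active for $g$ if the permutation of the two children induced by the section of $g$ at $v$ is nontrivial. Equivalently, for $g=(g_1,g_2)\sigma^i$, the root is active iff $i=1$, and the activity of the vertices in the two subtrees below the root is given by $g_1$ and $g_2$. The index of $g$ on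 $X^l$ is the number of active vertices of $g$ on $X^l$. *)

theory Defs
  imports "HOL-Algebra.Algebra"
begin

definition sigma :: "nat \<Rightarrow> nat"
  where "sigma = transpose 1 2"

definition C2 :: "(nat \<Rightarrow> nat) monoid"
  where "C2 = (sym_group 2)\<lparr>carrier := generate (sym_group 2) {sigma}\<rparr>"

text \<open>
  The groups \<open>B\<^sub>1 = C\<^sub>2\<close> and \<open>B\<^sub>k = B\<^sub>k\<^sub>-\<^sub>1 \<wr> C\<^sub>2\<close> for varying \<open>k\<close> have to live in a single HOL
  type.  \<open>Base p\<close> is the element \<open>p\<close> of \<open>B\<^sub>1 = C\<^sub>2\<close>, and \<open>Wr g\<^sub>1 g\<^sub>2 p\<close> is the element
  \<open>(g\<^sub>1, g\<^sub>2) p\<close> of a wreath product with \<open>C\<^sub>2\<close>.  The type also contains terms that belong to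
  no \<open>B\<^sub>k\<close>; the carriers below single out the intended elements.
\<close>

datatype wr_elt =
    Base "nat \<Rightarrow> nat"
  | Wr wr_elt wr_elt "nat \<Rightarrow> nat"

definition base_C2 :: "wr_elt monoid"
  where "base_C2 =
    \<lparr>carrier = Base ` carrier C2,
     monoid.mult = (\<lambda>g h. case (g, h) of (Base p, Base q) \<Rightarrow> Base (p \<otimes>\<^bsub>C2\<^esub> q) | _ \<Rightarrow> undefined),
     one = Base \<one>\<^bsub>C2\<^esub>\<rparr>"

definition coord :: "'a \<Rightarrow> 'a \<Rightarrow> nat \<Rightarrow> 'a"
  where "coord x\<^sub>1 x\<^sub>2 j = (if j = 1 then x\<^sub>1 else x\<^sub>2)"

definition wreath_C2 :: "wr_elt monoid \<Rightarrow> wr_elt monoid"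
  where "wreath_C2 B =
    \<lparr>carrier = {Wr g\<^sub>1 g\<^sub>2 p | g\<^sub>1 g\<^sub>2 p. g\<^sub>1 \<in> carrier B \<and> g\<^sub>2 \<in> carrier B \<and> p \<in> carrier C2},
     monoid.mult = (\<lambda>g h. case (g, h) of
         (Wr g\<^sub>1 g\<^sub>2 p, Wr h\<^sub>1 h\<^sub>2 q) \<Rightarrow>
           Wr (g\<^sub>1 \<otimes>\<^bsub>B\<^esub> coord h\<^sub>1 h\<^sub>2 (p 1)) (g\<^sub>2 \<otimes>\<^bsub>B\<^esub> coord h\<^sub>1 h\<^sub>2 (p 2)) (p \<otimes>\<^bsub>C2\<^esub> q)
       | _ \<Rightarrow> undefined),
     one = Wr \<one>\<^bsub>B\<^esub> \<one>\<^bsub>B\<^esub> \<one>\<^bsub>C2\<^esub>\<rparr>"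

text \<open>Only the indices \<open>k \<ge> 1\<close> are meaningful in the two families below.\<close>

fun Bk :: "nat \<Rightarrow> wr_elt monoid"
  where
    "Bk 0 = undefined"
  | "Bk (Suc 0) = base_C2"
  | "Bk (Suc (Suc k)) = wreath_C2 (Bk (Suc k))"

fun Gk :: "nat \<Rightarrow> wr_elt monoid"
  where
    "Gk 0 = undefined"
  | "Gk (Suc 0) = (Bk (Suc 0))\<lparr>carrier := {\<one>\<^bsub>Bk (Suc 0)\<^esub>}\<rparr>"
  | "Gk (Suc (Suc k)) = (Bk (Suc (Suc k)))\<lparr>carrier :=
       {Wr g\<^sub>1 g\<^sub>2 p | g\<^sub>1 g\<^sub>2 p. Wr g\<^sub>1 g\<^sub>2 p \<in> carrier (Bk (Suc (Suc k))) \<and>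
          g\<^sub>1 \<otimes>\<^bsub>Bk (Suc k)\<^esub> g\<^sub>2 \<in> carrier (Gk (Suc k))}\<rparr>"

text \<open>Vertices of level \<open>l\<close> of the rooted binary tree are the words of length \<open>l\<close> over \<open>{1, 2}\<close>.\<close>

definition level :: "nat \<Rightarrow> nat list set"
  where "level l = {v. length v = l \<and> set v \<subseteq> {1, 2}}"

text \<open>
  The last equation only concerns words of length at least \<open>k\<close>, which have no children in the
  tree with levels \<open>0, \<dots>, k\<close> on which \<open>B\<^sub>k\<close> acts.
\<close>

fun active :: "wr_elt \<Rightarrow> nat list \<Rightarrow> bool"
  where
    "active (Base p) [] \<longleftrightarrow> p \<noteq> \<one>\<^bsub>C2\<^esub>"
  | "active (Wr g\<^sub>1 g\<^sub>2 p) [] \<longleftrightarrow> p \<noteq> \<one>\<^bsub>C2\<^esub>"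
  | "active (Wr g\<^sub>1 g\<^sub>2 p) (x # v) \<longleftrightarrow> active (coord g\<^sub>1 g\<^sub>2 x) v"
  | "active (Base p) (x # v) \<longleftrightarrow> False"

definition index :: "nat \<Rightarrow> wr_elt \<Rightarrow> nat"
  where "index l g = card {v \<in> level l. active g v}"

end

theory Submission
  imports Defs
begin

text \<open>
  All level parities are homomorphisms on \<open>B\<^sub>k\<close>, \<open>G\<^sub>k\<close> is the kernel of the last one, and on
  \<open>G\<^sub>k\<close> the parity of the last level below the first vertex of level 1 is a homomorphism as well,
  because it agrees with the parity below the second vertex; this gives one direction.
  Conversely, write \<open>(a, b) = (ab, 1) (b\<inverse>, b)\<close>.  Here \<open>(b, b\<inverse>)\<close> is the commutator of
  \<open>(b, 1)\<close> and \<open>\<sigma>\<close>, and for \<open>b \<in> G\<^sub>k\<^sub>-\<^sub>1\<close> both lie in \<open>G\<^sub>k\<close>.  For \<open>x \<in> G\<^sub>k\<^sub>-\<^sub>1\<close> and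
  \<open>y \<in> B\<^sub>k\<^sub>-\<^sub>1\<close> the commutator of \<open>(x, 1)\<close> and \<open>(y, y\<inverse>)\<close> is \<open>([x, y], 1)\<close>; since \<open>G\<^sub>k\<^sub>-\<^sub>1\<close>
  has index 2 in \<open>B\<^sub>k\<^sub>-\<^sub>1\<close>, these commutators \<open>[x, y]\<close> already generate \<open>B\<^sub>k\<^sub>-\<^sub>1'\<close>.  The same
  decomposition shows by induction that \<open>B\<^sub>k'\<close> consists of the elements with all parities even.
\<close>

section \<open>The group of order two and wreath products with it\<close>

lemma one_C2: "\<one>\<^bsub>C2\<^esub> = id"
  by (simp add: C2_def sym_group_def)

lemma mult_C2: "p \<otimes>\<^bsub>C2\<^esub> q = p \<circ> q"
  by (simp add: C2_def sym_group_def)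

lemma sigma_simps [simp]: "sigma 1 = 2" "sigma (Suc 0) = 2" "sigma 2 = 1"
  "sigma (sigma x) = x" "sigma \<circ> sigma = id"
  by (simp_all add: sigma_def)

lemma sigma_neq_id [simp]: "sigma \<noteq> id" "id \<noteq> sigma"
  using sigma_simps(1) by (metis id_apply numeral_eq_one_iff semiring_norm(85))+

lemma carrier_C2: "carrier C2 = {id, sigma}"
proof -
  interpret S: group "sym_group 2"
    by (rule sym_group_is_group)
  have one: "\<one>\<^bsub>sym_group 2\<^esub> = id" and mult: "p \<otimes>\<^bsub>sym_group 2\<^esub> q = p \<circ> q" for p q
    by (simp_all add: sym_group_def)
  have s: "sigma \<in> carrier (sym_group 2)"
    unfolding sym_group_def sigma_def by (auto intro: permutes_swap_id)
  have inv: "inv\<^bsub>sym_group 2\<^esub> sigma = sigma"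
    by (rule S.inv_equality) (use s in \<open>simp_all add: one mult\<close>)
  have "x \<in> {id, sigma}" if "x \<in> generate (sym_group 2) {sigma}" for x
    using that by (induction rule: generate.induct) (auto simp: one mult inv)
  moreover have "id \<in> generate (sym_group 2) {sigma}"
    by (metis generate.one one)
  moreover have "sigma \<in> generate (sym_group 2) {sigma}"
    by (simp add: generate.incl)
  ultimately show ?thesis
    by (auto simp: C2_def)
qed

lemma coord_simps [simp]: "coord a b 1 = a" "coord a b (Suc 0) = a" "coord a b 2 = b"
  by (simp_all add: coord_def)

lemma base_mult: "Base p \<otimes>\<^bsub>base_C2\<^esub> Base q = Base (p \<circ> q)"
  by (simp add: base_C2_def mult_C2)

lemma base_one: "\<one>\<^bsub>base_C2\<^esub> = Base id"
  by (simp add: base_C2_def one_C2)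

lemma base_carrier: "carrier base_C2 = {Base id, Base sigma}"
  by (simp add: base_C2_def carrier_C2)

lemma group_base_C2: "group base_C2"
  by (rule groupI) (auto simp: base_carrier base_mult base_one)

lemma wreath_mult:
  "Wr a b p \<otimes>\<^bsub>wreath_C2 B\<^esub> Wr c d q
    = Wr (a \<otimes>\<^bsub>B\<^esub> coord c d (p 1)) (b \<otimes>\<^bsub>B\<^esub> coord c d (p 2)) (p \<circ> q)"
  by (simp add: wreath_C2_def mult_C2)

lemma wreath_one: "\<one>\<^bsub>wreath_C2 B\<^esub> = Wr \<one>\<^bsub>B\<^esub> \<one>\<^bsub>B\<^esub> id"
  by (simp add: wreath_C2_def one_C2)

lemma wreath_carrier:
  "x \<in> carrier (wreath_C2 B) \<longleftrightarrow>
    (\<exists>a b p. x = Wr a b p \<and> a \<in> carrier B \<and> b \<in> carrier B \<and> p \<in> {id, sigma})"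
  by (auto simp: wreath_C2_def carrier_C2)

lemma Wr_in_wreath [simp]:
  "Wr a b p \<in> carrier (wreath_C2 B) \<longleftrightarrow> a \<in> carrier B \<and> b \<in> carrier B \<and> p \<in> {id, sigma}"
  by (simp add: wreath_carrier)

lemma group_wreath_C2:
  assumes "group B"
  shows "group (wreath_C2 B)"
proof -
  interpret B: group B by fact
  show ?thesis
  proof (rule groupI)
    fix x assume "x \<in> carrier (wreath_C2 B)"
    then obtain a b p where x: "x = Wr a b p" "a \<in> carrier B" "b \<in> carrier B" "p \<in> {id, sigma}"
      by (auto simp: wreath_carrier)
    then consider "p = id" | "p = sigma" by blast
    then show "\<exists>y\<in>carrier (wreath_C2 B). y \<otimes>\<^bsub>wreath_C2 B\<^esub> x = \<one>\<^bsub>wreath_C2 B\<^esub>"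
    proof cases
      case 1
      then show ?thesis
        using x by (intro bexI[of _ "Wr (inv\<^bsub>B\<^esub> a) (inv\<^bsub>B\<^esub> b) id"])
          (auto simp: wreath_mult wreath_one)
    next
      case 2
      then show ?thesis
        using x by (intro bexI[of _ "Wr (inv\<^bsub>B\<^esub> b) (inv\<^bsub>B\<^esub> a) sigma"])
          (auto simp: wreath_mult wreath_one)
    qed
  qed (auto simp: wreath_carrier wreath_mult wreath_one B.m_assoc)
qed

lemma group_Bk: "group (Bk (Suc n))"
  by (induction n) (simp_all add: group_base_C2 group_wreath_C2)

section \<open>Parities of the indices on levels, and \<open>Gk\<close> as a parity kernel\<close>

lemma level_0: "level 0 = {[]}"
  by (auto simp: level_def)

lemma level_Suc: "level (Suc l) = (#) 1 ` level l \<union> (#) 2 ` level l"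
  by (auto simp: level_def length_Suc_conv image_iff)

lemma finite_level: "finite (level l)"
  by (induction l) (simp_all add: level_0 level_Suc)

lemma index_0_Wr: "index 0 (Wr a b p) = (if p = id then 0 else 1)"
proof -
  have "{v \<in> level 0. active (Wr a b p) v} = (if p = id then {} else {[]})"
    by (auto simp: level_0 one_C2)
  then show ?thesis by (simp add: index_def)
qed

lemma index_0_Base: "index 0 (Base p) = (if p = id then 0 else 1)"
proof -
  have "{v \<in> level 0. active (Base p) v} = (if p = id then {} else {[]})"
    by (auto simp: level_0 one_C2)
  then show ?thesis by (simp add: index_def)
qed

lemma index_Suc_Base: "index (Suc l) (Base p) = 0"
proof -
  have "{v \<in> level (Suc l). active (Base p) v} = {}"
    by (auto simp: level_Suc)
  then show ?thesis by (simp only: index_def card.empty)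
qed

lemma index_Suc_Wr: "index (Suc l) (Wr a b p) = index l a + index l b"
proof -
  have "{v \<in> level (Suc l). active (Wr a b p) v}
      = (#) 1 ` {v \<in> level l. active a v} \<union> (#) 2 ` {v \<in> level l. active b v}"
    by (auto simp: level_Suc)
  moreover have "card \<dots> = card ((#) (1::nat) ` {v \<in> level l. active a v})
      + card ((#) (2::nat) ` {v \<in> level l. active b v})"
    by (rule card_Un_disjoint) (auto simp: finite_level)
  ultimately show ?thesis
    by (simp add: index_def card_image)
qed

lemmas index_simps = index_0_Wr index_0_Base index_Suc_Base index_Suc_Wr

text \<open>A product merely permutes the two coordinates of \<open>h\<close> before multiplying
  them in. Below the root the index is the sum over both coordinates, so the swap cancels out; at
  the root the parity is the sign of \<open>p\<close>.\<close>

lemma even_index_mult: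
  assumes "g \<in> carrier (Bk (Suc n))" "h \<in> carrier (Bk (Suc n))"
  shows "even (index l (g \<otimes>\<^bsub>Bk (Suc n)\<^esub> h)) \<longleftrightarrow> (even (index l g) \<longleftrightarrow> even (index l h))"
  using assms
proof (induction n arbitrary: g h l)
  case 0
  then show ?case
    by (cases l) (auto simp: base_carrier base_mult index_simps)
next
  case (Suc n)
  then show ?case
    by (cases l) (auto simp: wreath_carrier wreath_mult index_simps)
qed

lemma even_index_one: "even (index l \<one>\<^bsub>Bk (Suc n)\<^esub>)"
proof -
  interpret B: group "Bk (Suc n)" by (rule group_Bk)
  show ?thesis
    using even_index_mult[of "\<one>\<^bsub>Bk (Suc n)\<^esub>" n "\<one>\<^bsub>Bk (Suc n)\<^esub>" l] by simp
qed

lemma even_index_inv: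
  assumes "g \<in> carrier (Bk (Suc n))"
  shows "even (index l (inv\<^bsub>Bk (Suc n)\<^esub> g)) \<longleftrightarrow> even (index l g)"
proof -
  interpret B: group "Bk (Suc n)" by (rule group_Bk)
  show ?thesis
    using even_index_mult[of "inv\<^bsub>Bk (Suc n)\<^esub> g" n g l] even_index_one[of l n] assms by simp
qed

text \<open>By induction the condition on the product of the two coordinates is that their indices
  on level \<open>n\<close> have an even sum, and this sum is the index of the whole element one
  level lower in the tree.\<close>

lemma Gk_carrier: "carrier (Gk (Suc n)) = {g \<in> carrier (Bk (Suc n)). even (index n g)}"
proof (induction n)
  case 0
  then show ?case
    by (auto simp: base_carrier base_one index_simps)
next
  case (Suc n)
  interpret B: group "Bk (Suc n)" by (rule group_Bk)
  show ?case
    by (auto simp: Suc wreath_carrier index_simps even_index_mult)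
qed

lemma Gk_eq: "Gk (Suc n) = (Bk (Suc n))\<lparr>carrier := carrier (Gk (Suc n))\<rparr>"
  by (cases n) simp_all

lemma Gk_subgroup: "subgroup (carrier (Gk (Suc n))) (Bk (Suc n))"
proof -
  interpret B: group "Bk (Suc n)" by (rule group_Bk)
  show ?thesis
    by (rule B.subgroupI)
      (use even_index_one[of n n] in \<open>auto simp: Gk_carrier even_index_mult even_index_inv\<close>)
qed

section \<open>Derived subgroups and commutators in wreath products\<close>

lemma (in group) derived_parity_even:
  assumes S: "subgroup S G"
    and hom: "\<And>x y. x \<in> S \<Longrightarrow> y \<in> S \<Longrightarrow> P (x \<otimes> y) \<longleftrightarrow> (P x \<longleftrightarrow> P y)"
    and g: "g \<in> derived G S"
  shows "P g"
proof -
  interpret S: subgroup S G by (rule S)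
  have one: "P \<one>"
    using hom[OF S.one_closed S.one_closed] by simp
  have inv: "P (inv x) \<longleftrightarrow> P x" if "x \<in> S" for x
    using hom[OF _ that, of "inv x"] that one by simp
  \<comment> \<open>On \<open>S\<close> the predicate is a homomorphism to the abelian group of
    order two, so its kernel contains all commutators. Asking for this only on \<open>S\<close>
    matters: one later choice of \<open>P\<close> is not multiplicative on the whole group.\<close>
  have "subgroup {x \<in> S. P x} G"
    by (rule subgroupI) (use S.subset in \<open>auto simp: inv hom intro!: exI[of _ \<one>] one\<close>)
  moreover have "derived_set G S \<subseteq> {x \<in> S. P x}"
    by (auto simp: hom inv)
  ultimately have "derived G S \<subseteq> {x \<in> S. P x}"
    unfolding derived_def by (intro generate_subgroup_incl)
  then show ?thesis
    using g by blast
qed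

lemma wreath_inv:
  assumes "group B" "a \<in> carrier B" "b \<in> carrier B"
  shows "inv\<^bsub>wreath_C2 B\<^esub> (Wr a b id) = Wr (inv\<^bsub>B\<^esub> a) (inv\<^bsub>B\<^esub> b) id"
    and "inv\<^bsub>wreath_C2 B\<^esub> (Wr a b sigma) = Wr (inv\<^bsub>B\<^esub> b) (inv\<^bsub>B\<^esub> a) sigma"
proof -
  interpret B: group B by fact
  interpret W: group "wreath_C2 B" by (rule group_wreath_C2) fact
  show "inv\<^bsub>wreath_C2 B\<^esub> (Wr a b id) = Wr (inv\<^bsub>B\<^esub> a) (inv\<^bsub>B\<^esub> b) id"
    by (rule W.inv_equality) (use assms in \<open>auto simp: wreath_mult wreath_one\<close>)
  show "inv\<^bsub>wreath_C2 B\<^esub> (Wr a b sigma) = Wr (inv\<^bsub>B\<^esub> b) (inv\<^bsub>B\<^esub> a) sigma"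
    by (rule W.inv_equality) (use assms in \<open>auto simp: wreath_mult wreath_one\<close>)
qed

lemma (in group) commutator_in_derived:
  "x \<in> S \<Longrightarrow> y \<in> S \<Longrightarrow> x \<otimes> y \<otimes> inv x \<otimes> inv y \<in> derived G S"
  unfolding derived_def by (rule generate.incl) blast

text \<open>Covers two cases at once: \<open>S\<close> the full wreath product with \<open>C\<close>
  all of \<open>B\<close>, and \<open>S\<close> the group \<open>Gk\<close> with \<open>C\<close>
  the preceding one. The assumption \<open>index2\<close> says that \<open>C\<close> has at most one
  nontrivial coset.\<close>

lemma wreath_derivedI:
  assumes B: "group B"
    and C: "C \<subseteq> carrier B"
    and index2: "\<And>x y. x \<in> carrier B - C \<Longrightarrow> y \<in> carrier B - C \<Longrightarrow> x \<otimes>\<^bsub>B\<^esub> inv\<^bsub>B\<^esub> y \<in> C"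
    and S: "S \<subseteq> carrier (wreath_C2 B)"
    and S_sigma: "Wr \<one>\<^bsub>B\<^esub> \<one>\<^bsub>B\<^esub> sigma \<in> S"
    and S_C: "\<And>c. c \<in> C \<Longrightarrow> Wr c \<one>\<^bsub>B\<^esub> id \<in> S"
    and S_B: "\<And>y. y \<in> carrier B \<Longrightarrow> Wr y (inv\<^bsub>B\<^esub> y) id \<in> S"
    and b: "b \<in> C" and a: "a \<in> carrier B" and ab: "a \<otimes>\<^bsub>B\<^esub> b \<in> derived B (carrier B)"
  shows "Wr a b id \<in> derived (wreath_C2 B) S"
proof -
  interpret B: group B by fact
  interpret W: group "wreath_C2 B" by (rule group_wreath_C2) fact
  let ?D = "derived (wreath_C2 B) S"
  interpret D: subgroup ?D "wreath_C2 B"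
    by (rule W.derived_is_subgroup[OF S])
  have comm: "u \<otimes>\<^bsub>wreath_C2 B\<^esub> v \<otimes>\<^bsub>wreath_C2 B\<^esub> inv\<^bsub>wreath_C2 B\<^esub> u \<otimes>\<^bsub>wreath_C2 B\<^esub> inv\<^bsub>wreath_C2 B\<^esub> v \<in> ?D"
    if "u \<in> S" "v \<in> S" for u v
    using that by (rule W.commutator_in_derived)
  \<comment> \<open>The commutator of \<open>(c, 1)\<close> with the swap is
    \<open>(c, inv c)\<close>; its inverse is taken.\<close>
  have anti: "Wr (inv\<^bsub>B\<^esub> c) c id \<in> ?D" if c: "c \<in> C" for c
    using D.m_inv_closed[OF comm[OF S_C[OF c] S_sigma]] C c
    by (auto simp: wreath_mult wreath_inv B subset_iff)
  have CB: "Wr (x \<otimes>\<^bsub>B\<^esub> y \<otimes>\<^bsub>B\<^esub> inv\<^bsub>B\<^esub> x \<otimes>\<^bsub>B\<^esub> inv\<^bsub>B\<^esub> y) \<one>\<^bsub>B\<^esub> id \<in> ?D"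
    if x: "x \<in> C" and y: "y \<in> carrier B" for x y
    using comm[OF S_C[OF x] S_B[OF y]] C x y
    by (auto simp: wreath_mult wreath_inv B subset_iff)
  have BB: "Wr (x \<otimes>\<^bsub>B\<^esub> y \<otimes>\<^bsub>B\<^esub> inv\<^bsub>B\<^esub> x \<otimes>\<^bsub>B\<^esub> inv\<^bsub>B\<^esub> y) \<one>\<^bsub>B\<^esub> id \<in> ?D"
    if x: "x \<in> carrier B" and y: "y \<in> carrier B" for x y
  proof -
    consider "x \<in> C" | "y \<in> C" | "x \<in> carrier B - C" "y \<in> carrier B - C"
      using x y by blast
    then show ?thesis
    proof cases
      case 1
      then show ?thesis using CB y by blast
    next
      case 2
      \<comment> \<open>Exchanging the two arguments inverts a commutator, which reduces to the
        previous case.\<close>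
      have "inv\<^bsub>wreath_C2 B\<^esub> (Wr (y \<otimes>\<^bsub>B\<^esub> x \<otimes>\<^bsub>B\<^esub> inv\<^bsub>B\<^esub> y \<otimes>\<^bsub>B\<^esub> inv\<^bsub>B\<^esub> x) \<one>\<^bsub>B\<^esub> id)
          = Wr (x \<otimes>\<^bsub>B\<^esub> y \<otimes>\<^bsub>B\<^esub> inv\<^bsub>B\<^esub> x \<otimes>\<^bsub>B\<^esub> inv\<^bsub>B\<^esub> y) \<one>\<^bsub>B\<^esub> id"
        using x y by (simp add: wreath_inv B B.inv_mult_group B.m_assoc)
      then show ?thesis using D.m_inv_closed[OF CB[OF 2 x]] by simp
    next
      case 3
      \<comment> \<open>Two elements outside \<open>C\<close> differ by some \<open>z\<close> in
        \<open>C\<close>, and \<open>[z y, y] = [z, y]\<close>.\<close>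
      define z where "z = x \<otimes>\<^bsub>B\<^esub> inv\<^bsub>B\<^esub> y"
      have z: "z \<in> C" "z \<in> carrier B" and xz: "x = z \<otimes>\<^bsub>B\<^esub> y"
        using index2[OF 3] x y by (auto simp: z_def B.m_assoc)
      have "x \<otimes>\<^bsub>B\<^esub> y \<otimes>\<^bsub>B\<^esub> inv\<^bsub>B\<^esub> x \<otimes>\<^bsub>B\<^esub> inv\<^bsub>B\<^esub> y
          = z \<otimes>\<^bsub>B\<^esub> y \<otimes>\<^bsub>B\<^esub> inv\<^bsub>B\<^esub> z \<otimes>\<^bsub>B\<^esub> inv\<^bsub>B\<^esub> y"
        using z y by (simp add: xz B.inv_mult_group B.m_assoc B.m_assoc[symmetric, of y "inv\<^bsub>B\<^esub> y"])
      then show ?thesis using CB[OF z(1) y] by simp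
    qed
  qed
  \<comment> \<open>Being the preimage of a subgroup under \<open>d \<mapsto> (d, 1)\<close>, this
    set contains the derived subgroup of \<open>B\<close> once it contains the commutators.\<close>
  let ?H = "{d \<in> carrier B. Wr d \<one>\<^bsub>B\<^esub> id \<in> ?D}"
  have "subgroup ?H B"
  proof (rule B.subgroupI)
    show "?H \<noteq> {}"
      using D.one_closed unfolding wreath_one by blast
  next
    fix c assume "c \<in> ?H"
    then show "inv\<^bsub>B\<^esub> c \<in> ?H"
      using D.m_inv_closed[of "Wr c \<one>\<^bsub>B\<^esub> id"] by (simp add: wreath_inv B)
  next
    fix c d assume "c \<in> ?H" "d \<in> ?H"
    then show "c \<otimes>\<^bsub>B\<^esub> d \<in> ?H"
      using D.m_closed[of "Wr c \<one>\<^bsub>B\<^esub> id" "Wr d \<one>\<^bsub>B\<^esub> id"] by (simp add: wreath_mult)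
  qed blast
  moreover have "derived_set B (carrier B) \<subseteq> ?H"
    using BB by auto
  ultimately have fst: "derived B (carrier B) \<subseteq> ?H"
    unfolding derived_def by (intro B.generate_subgroup_incl)
  have "Wr (a \<otimes>\<^bsub>B\<^esub> b) \<one>\<^bsub>B\<^esub> id \<otimes>\<^bsub>wreath_C2 B\<^esub> Wr (inv\<^bsub>B\<^esub> b) b id \<in> ?D"
    using fst ab anti[OF b] by (blast intro: D.m_closed)
  moreover have "Wr (a \<otimes>\<^bsub>B\<^esub> b) \<one>\<^bsub>B\<^esub> id \<otimes>\<^bsub>wreath_C2 B\<^esub> Wr (inv\<^bsub>B\<^esub> b) b id = Wr a b id"
    using a b C by (auto simp: wreath_mult B.m_assoc subset_iff)
  ultimately show ?thesis by simp
qed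

lemma derived_BkI:
  assumes "g \<in> carrier (Bk (Suc n))" "\<And>l. l \<le> n \<Longrightarrow> even (index l g)"
  shows "g \<in> derived (Bk (Suc n)) (carrier (Bk (Suc n)))"
  using assms
proof (induction n arbitrary: g)
  case 0
  then have "g = \<one>\<^bsub>base_C2\<^esub>"
    using "0.prems"(2)[of 0]
    by (auto simp: base_carrier base_one index_simps)
  then show ?case
    by (simp add: derived_def generate.one)
next
  case (Suc n)
  interpret B: group "Bk (Suc n)" by (rule group_Bk)
  obtain a b p where g: "g = Wr a b p" and a: "a \<in> carrier (Bk (Suc n))"
    and b: "b \<in> carrier (Bk (Suc n))" and p: "p \<in> {id, sigma}"
    using Suc.prems(1) by (auto simp: wreath_carrier)
  have p: "p = id"
    using Suc.prems(2)[of 0] by (auto simp: g index_simps split: if_splits)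
  \<comment> \<open>Level \<open>l\<close> of the product \<open>a b\<close> has the parity of level
    \<open>l + 1\<close> of \<open>g\<close>.\<close>
  have "even (index l (a \<otimes>\<^bsub>Bk (Suc n)\<^esub> b))" if "l \<le> n" for l
    using Suc.prems(2)[of "Suc l"] that a b by (simp add: g index_simps even_index_mult)
  then have "a \<otimes>\<^bsub>Bk (Suc n)\<^esub> b \<in> derived (Bk (Suc n)) (carrier (Bk (Suc n)))"
    using Suc.IH a b by blast
  then show ?case
    unfolding g p Bk.simps
    \<comment> \<open>With \<open>C\<close> the whole carrier, \<open>index2\<close> is
      vacuous.\<close>
    by (intro wreath_derivedI[where C = "carrier (Bk (Suc n))"])
      (use a b in \<open>auto simp: group_Bk\<close>)
qed

text \<open>Moves the commutators, in particular their inverses, into \<open>Bk\<close>, where the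
  parity lemmas apply.\<close>

lemma derived_Gk_eq:
  "derived (Gk (Suc n)) (carrier (Gk (Suc n))) = derived (Bk (Suc n)) (carrier (Gk (Suc n)))"
proof -
  interpret B: group "Bk (Suc n)" by (rule group_Bk)
  show ?thesis
    using B.derived_consistent[OF subset_refl Gk_subgroup[of n]] Gk_eq[of n] by simp
qed

theorem lemma17:
  fixes k i :: nat and g g\<^sub>1 g\<^sub>2 :: wr_elt
  assumes "k \<ge> 2"
    and "g\<^sub>1 \<in> carrier (Bk (k - 1))" and "g\<^sub>2 \<in> carrier (Bk (k - 1))"
    and "i \<in> {0, 1}"
    and "g = Wr g\<^sub>1 g\<^sub>2 (sigma [^]\<^bsub>C2\<^esub> i)"
    and "g \<in> carrier (Bk k)"
  shows "g \<in> derived (Gk k) (carrier (Gk k)) \<longleftrightarrow>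
    g \<in> carrier (Gk k) \<and>
    (\<forall>l < k - 1. even (index l g)) \<and>
    even (index (k - 2) g\<^sub>1) \<and> even (index (k - 2) g\<^sub>2)"
proof -
  define n where "n = k - 2"
  have k: "k = Suc (Suc n)" "k - 1 = Suc n" "k - 2 = n"
    using assms(1) by (simp_all add: n_def)
  define p where "p = sigma [^]\<^bsub>C2\<^esub> i"
  have g: "g = Wr g\<^sub>1 g\<^sub>2 p"
    using assms(5) by (simp add: p_def)
  have g1: "g\<^sub>1 \<in> carrier (Bk (Suc n))" and g2: "g\<^sub>2 \<in> carrier (Bk (Suc n))"
    using assms(2,3) k by simp_all
  interpret B: group "Bk (Suc n)" by (rule group_Bk)
  interpret W: group "Bk (Suc (Suc n))" by (rule group_Bk)
  let ?S = "carrier (Gk (Suc (Suc n)))"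
  note S = Gk_subgroup[of "Suc n"]
  have "g \<in> derived (Bk (Suc (Suc n))) ?S \<longleftrightarrow>
    g \<in> ?S \<and> (\<forall>l < Suc n. even (index l g)) \<and> even (index n g\<^sub>1) \<and> even (index n g\<^sub>2)"
  proof (intro iffI conjI allI impI)
    assume D: "g \<in> derived (Bk (Suc (Suc n))) ?S"
    show gS: "g \<in> ?S"
      using W.derived_incl[OF subset_refl S] D by blast
    show "even (index l g)" for l
      by (rule W.derived_parity_even[OF S _ D]) (rule even_index_mult; simp add: Gk_carrier del: Gk.simps)
    \<comment> \<open>Multiplicative on \<open>?S\<close> only: a swap brings in the second
      coordinate of the right factor in place of the first, and in \<open>Gk\<close> both have the
      same parity on level \<open>n\<close>. The default is never reached, as all elements are of
      the form \<open>Wr\<close>.\<close>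
    define P where "P x = (case x of Wr a b q \<Rightarrow> even (index n a) | _ \<Rightarrow> undefined)" for x
    have "P g"
      by (rule W.derived_parity_even[OF S _ D])
        (auto simp: Gk_carrier wreath_carrier wreath_mult P_def even_index_mult index_simps
          simp del: Gk.simps)
    then show "even (index n g\<^sub>1)"
      by (simp add: P_def g)
    then show "even (index n g\<^sub>2)"
      using gS by (simp add: Gk_carrier g index_simps del: Gk.simps)
  next
    assume *: "g \<in> ?S \<and> (\<forall>l < Suc n. even (index l g)) \<and> even (index n g\<^sub>1) \<and> even (index n g\<^sub>2)"
    then have p: "p = id"
      by (force simp: g index_simps split: if_splits)
    have "even (index l (g\<^sub>1 \<otimes>\<^bsub>Bk (Suc n)\<^esub> g\<^sub>2))" if "l \<le> n" for l
    proof (cases "l = n")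
      \<comment> \<open>Level \<open>n\<close> of the product is level \<open>n + 1\<close> of
        \<open>g\<close>, beyond the range of the hypothesis on \<open>g\<close>; the separate
        conditions on the two subtrees cover it.\<close>
      case True
      then show ?thesis using * g1 g2 by (simp add: even_index_mult)
    next
      case False
      then have "even (index (Suc l) g)" using * that by simp
      then show ?thesis using g1 g2 by (simp add: g index_simps even_index_mult)
    qed
    then have "g\<^sub>1 \<otimes>\<^bsub>Bk (Suc n)\<^esub> g\<^sub>2 \<in> derived (Bk (Suc n)) (carrier (Bk (Suc n)))"
      using derived_BkI g1 g2 by blast
    then show "g \<in> derived (Bk (Suc (Suc n))) ?S"
      unfolding g p Bk.simps
      \<comment> \<open>The condition on \<open>g\<^sub>2\<close> puts it into \<open>C\<close>. The
        swap, \<open>(c, 1)\<close> and \<open>(y, inv y)\<close> lie in \<open>?S\<close> since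
        their last-level parities are even, and two odd elements have an even quotient.\<close>
      by (intro wreath_derivedI[where C = "carrier (Gk (Suc n))"])
        (use * g1 g2 in \<open>auto simp: group_Bk Gk_carrier even_index_mult even_index_inv
          even_index_one index_simps simp del: Gk.simps\<close>)
  qed
  then show ?thesis
    unfolding k(2,3) by (simp only: k(1) derived_Gk_eq)
qed

end
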